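(* There is no strategy-proof algorithm (mechanism) that finds a stable matching in the geometric preference model.
   Context: A matching market has $n$ men and $n$ women. In the $d$-dimensional geometric model every participant $x$ has a location $p(x)\in\mathbb{R}^d$ and an ideal $q(x)\in\mathbb{R}^d$; a man $m$ prefers woman $w_1$ to $w_2$ iff $\|q(m)-p(w_1)\|_2^2<\|q(m)-p(w_2)\|_2^2$, and symmetrically for women. A matching $\mu$ is stable if there is no pair $(m,w)\notin\mu$ with $m$ strictly preferring $w$ to $\mu(m)$ and $w$ strictly preferring $m$ to $\mu(w)$. A mechanism takes the reported ideals of all participants (locations are fixed and cannot be misreported) and outputs a matching stable with respect to the reported preferences. It is strategy-proof if no participant can ever obtain a partner he or she strictly prefers (according to the true ideal) by reporting a different ideal while all others report truthfully. *)

theory Defs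
  imports "HOL-Analysis.Analysis"
begin

text \<open>
  A market with n men and n women has the participants \<open>Man i\<close> and \<open>Woman i\<close> for \<open>i < n\<close>.
  Locations and ideals are functions on the whole type; their values at indices \<open>\<ge> n\<close>
  never enter preferences within the market.
\<close>

datatype participant = Man nat | Woman nat

definition men :: "nat \<Rightarrow> participant set" where
  "men n = Man ` {..<n}"

definition women :: "nat \<Rightarrow> participant set" where
  "women n = Woman ` {..<n}"

text \<open>
  \<open>prefers p q x a b\<close>: with locations \<open>p\<close> and ideals \<open>q\<close>, participant \<open>x\<close> strictly prefers
  \<open>a\<close> to \<open>b\<close>. Equidistant partners are ties. The norm on \<open>real ^ 'd\<close> is Euclidean.
\<close>

definition prefers ::
  "(participant \<Rightarrow> real ^ 'd) \<Rightarrow> (participant \<Rightarrow> real ^ 'd) \<Rightarrow>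
    participant \<Rightarrow> participant \<Rightarrow> participant \<Rightarrow> bool" where
  "prefers p q x a b \<longleftrightarrow> (norm (q x - p a))\<^sup>2 < (norm (q x - p b))\<^sup>2"

text \<open>
  A matching is given by its partner map, so the pair \<open>(m, w)\<close> belongs to the matching
  \<open>\<mu>\<close> iff \<open>\<mu> m = w\<close>. The second conjunct makes \<open>\<mu>\<close> on the women the inverse of
  \<open>\<mu>\<close> on the men.
\<close>

definition matching :: "nat \<Rightarrow> (participant \<Rightarrow> participant) \<Rightarrow> bool" where
  "matching n \<mu> \<longleftrightarrow> bij_betw \<mu> (men n) (women n) \<and> (\<forall>m\<in>men n. \<mu> (\<mu> m) = m)"

definition stable_matching ::
  "nat \<Rightarrow> (participant \<Rightarrow> real ^ 'd) \<Rightarrow> (participant \<Rightarrow> real ^ 'd) \<Rightarrow>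
    (participant \<Rightarrow> participant) \<Rightarrow> bool" where
  "stable_matching n p q \<mu> \<longleftrightarrow> matching n \<mu> \<and>
    \<not> (\<exists>m\<in>men n. \<exists>w\<in>women n.
          \<mu> m \<noteq> w \<and> prefers p q m w (\<mu> m) \<and> prefers p q w m (\<mu> w))"

text \<open>
  A mechanism maps the size of the market, the (publicly known) locations and the reported
  ideals to a partner map. No computability is required.
\<close>

type_synonym 'd mechanism =
  "nat \<Rightarrow> (participant \<Rightarrow> real ^ 'd) \<Rightarrow> (participant \<Rightarrow> real ^ 'd) \<Rightarrow>
    (participant \<Rightarrow> participant)"

definition finds_stable_matching :: "('d::finite) mechanism \<Rightarrow> bool" where
  "finds_stable_matching F \<longleftrightarrow> (\<forall>n p q. stable_matching n p q (F n p q))"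

text \<open>
  Here \<open>q\<close> is the profile of true ideals and \<open>r\<close> the ideal reported by \<open>x\<close>; the two
  outcomes are compared according to the true ideal of \<open>x\<close>.
\<close>

definition strategy_proof :: "('d::finite) mechanism \<Rightarrow> bool" where
  "strategy_proof F \<longleftrightarrow>
    (\<forall>n p q. \<forall>x\<in>men n \<union> women n. \<forall>r.
        \<not> prefers p q x (F n p (q(x := r)) x) (F n p q x))"

end

theory Submission
  imports Defs
begin

text \<open>
  Three men and three women live at the positions 0, 2 and 5 of a line. The true ideals give the
  preference lists

    Man 0: 0, 1, 2   Man 1: 1, 0, 2   Man 2: 0, 1, 2
    Woman 0: 1, 0, 2   Woman 1: 0, 1, 2   Woman 2: 0, 1, 2

  for which exactly two matchings are stable: the identity and the one that exchanges 0 and 1.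
  By moving the reported ideal from 2 to 3, a participant changes the list 1, 0, 2 into 1, 2, 0.
  If Woman 0 does so, the exchange becomes the only stable matching, which she prefers to the
  identity; if Man 1 does so, the identity becomes the only stable matching, which he prefers to
  the exchange. So whichever stable matching the mechanism selects, somebody gains by lying.
\<close>

text \<open>A unit vector embeds the real line isometrically, so a counterexample on a line serves
  every dimension.\<close>

lemma prefers_line:
  fixes e :: "real ^ 'd"
  assumes "norm e = 1"
  shows "prefers (\<lambda>x. P x *\<^sub>R e) (\<lambda>x. Q x *\<^sub>R e) x a b \<longleftrightarrow> (Q x - P a)\<^sup>2 < (Q x - P b)\<^sup>2"
  using assms by (simp add: prefers_def flip: scaleR_left_diff_distrib)

lemma men_3: "men 3 = {Man 0, Man 1, Man 2}"
  by (auto simp: men_def numeral_3_eq_3 lessThan_Suc)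

lemma women_3: "women 3 = {Woman 0, Woman 1, Woman 2}"
  by (auto simp: women_def numeral_3_eq_3 lessThan_Suc)

text \<open>Both directions of \<mu> are listed because a blocking condition evaluates it at a man
  and at a woman.\<close>

lemma matching_3_cases:
  assumes "matching 3 \<mu>"
  obtains i j k where "(i, j, k) \<in> {(0,1,2), (0,2,1), (1,0,2), (1,2,0), (2,0,1), (2,1,0)}"
    and "\<mu> (Man 0) = Woman i" "\<mu> (Man 1) = Woman j" "\<mu> (Man 2) = Woman k"
    and "\<mu> (Woman i) = Man 0" "\<mu> (Woman j) = Man 1" "\<mu> (Woman k) = Man 2"
proof -
  have bij: "bij_betw \<mu> (men 3) (women 3)" and inv: "\<forall>m\<in>men 3. \<mu> (\<mu> m) = m"
    using assms by (auto simp: matching_def)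
  have "\<mu> m \<in> women 3" if "m \<in> men 3" for m
    using bij that by (rule bij_betw_apply)
  then obtain i j k where ijk: "i \<in> {0, 1, 2}" "j \<in> {0, 1, 2}" "k \<in> {0, 1, 2}"
    and \<mu>: "\<mu> (Man 0) = Woman i" "\<mu> (Man 1) = Woman j" "\<mu> (Man 2) = Woman k"
    unfolding men_3 women_3 by (metis insert_iff empty_iff)
  have inv': "\<mu> (Woman i) = Man 0" "\<mu> (Woman j) = Man 1" "\<mu> (Woman k) = Man 2"
    using inv by (simp_all add: men_3 flip: \<mu>)
  then have "i \<noteq> j" "i \<noteq> k" "j \<noteq> k"
    by auto
  then show thesis
    using ijk by (intro that[OF _ \<mu> inv']) auto
qed

text \<open>The ideals 2 and 3 are both nearest to position 2, but the midpoint 5/2 of 0 and 5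
  separates them, so the lie swaps only the two lower choices.\<close>

fun pos :: "participant \<Rightarrow> real" where
  "pos (Man i) = (if i = 0 then 0 else if i = 1 then 2 else 5)"
| "pos (Woman i) = (if i = 0 then 0 else if i = 1 then 2 else 5)"

definition ideal :: "participant \<Rightarrow> real" where
  "ideal x = (if x \<in> {Man 1, Woman 0} then 2 else 0)"

lemma stable_matching_line:
  fixes e :: "real ^ 'd"
  assumes "norm e = 1"
    and "stable_matching 3 (\<lambda>x. pos x *\<^sub>R e) (\<lambda>x. Q x *\<^sub>R e) \<mu>"
  shows "matching 3 \<mu>"
    and "\<And>m w. m \<in> men 3 \<Longrightarrow> w \<in> women 3 \<Longrightarrow>
      \<mu> m = w \<or> (Q m - pos (\<mu> m))\<^sup>2 \<le> (Q m - pos w)\<^sup>2 \<or> (Q w - pos (\<mu> w))\<^sup>2 \<le> (Q w - pos m)\<^sup>2"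
  using assms unfolding stable_matching_def by (auto simp: prefers_line not_less; meson not_less)+

text \<open>\<open>Man 2\<close> and \<open>Woman 2\<close> are last on every list, so they are
  matched to each other: otherwise their partners would block.\<close>

lemma stable_true:
  fixes e :: "real ^ 'd"
  assumes "norm e = 1"
    and "stable_matching 3 (\<lambda>x. pos x *\<^sub>R e) (\<lambda>x. ideal x *\<^sub>R e) \<mu>"
  shows "\<mu> (Man 1) = Woman 1 \<and> \<mu> (Woman 0) = Man 0 \<or> \<mu> (Man 1) = Woman 0 \<and> \<mu> (Woman 0) = Man 1"
  using stable_matching_line(1)[OF assms] stable_matching_line(2)[OF assms]
  by (elim matching_3_cases) (force simp: men_3 women_3 ideal_def)

text \<open>With the reported list 1, 2, 0 of \<open>Woman 0\<close>, the identity is blocked by her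
  and \<open>Man 2\<close>, who prefers her to \<open>Woman 2\<close>.\<close>

lemma stable_Woman_0_lies:
  fixes e :: "real ^ 'd"
  assumes "norm e = 1"
    and "stable_matching 3 (\<lambda>x. pos x *\<^sub>R e) (\<lambda>x. (ideal(Woman 0 := 3)) x *\<^sub>R e) \<mu>"
  shows "\<mu> (Woman 0) = Man 1"
  using stable_matching_line(1)[OF assms] stable_matching_line(2)[OF assms]
  by (elim matching_3_cases) (force simp: men_3 women_3 ideal_def)

text \<open>Now \<open>Man 1\<close> and \<open>Woman 2\<close> block the exchange, as she prefers
  him to \<open>Man 2\<close>.\<close>

lemma stable_Man_1_lies:
  fixes e :: "real ^ 'd"
  assumes "norm e = 1"
    and "stable_matching 3 (\<lambda>x. pos x *\<^sub>R e) (\<lambda>x. (ideal(Man 1 := 3)) x *\<^sub>R e) \<mu>"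
  shows "\<mu> (Man 1) = Woman 1"
  using stable_matching_line(1)[OF assms] stable_matching_line(2)[OF assms]
  by (elim matching_3_cases) (force simp: men_3 women_3 ideal_def)

theorem theorem12:
  shows "\<not> (\<exists>F :: ('d::finite) mechanism. finds_stable_matching F \<and> strategy_proof F)"
proof
  assume "\<exists>F :: 'd mechanism. finds_stable_matching F \<and> strategy_proof F"
  then obtain F :: "'d mechanism" where F: "finds_stable_matching F" "strategy_proof F"
    by blast
  \<comment> \<open>\<open>undefined\<close> serves as an arbitrary coordinate; any unit vector
    would do.\<close>
  define e :: "real ^ 'd" where "e = axis undefined 1"
  have e: "norm e = 1"
    by (simp add: e_def)
  define p where "p = (\<lambda>x. pos x *\<^sub>R e)"
  define q where "q Q = (\<lambda>x. Q x *\<^sub>R e)" for Q :: "participant \<Rightarrow> real"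
  have stable: "stable_matching 3 p (q Q) (F 3 p (q Q))" for Q
    using F(1) by (simp add: finds_stable_matching_def)
  \<comment> \<open>A lie on the line is thus a single changed report in the space, as
    \<open>strategy_proof\<close> requires.\<close>
  have upd: "q (Q(x := r)) = (q Q)(x := r *\<^sub>R e)" for Q x r
    by (auto simp: q_def)
  have no_gain: "\<not> prefers p (q ideal) x (F 3 p (q (ideal(x := 3))) x) (F 3 p (q ideal) x)"
    if "x \<in> men 3 \<union> women 3" for x
    using F(2) that unfolding strategy_proof_def upd by blast
  have W: "F 3 p (q (ideal(Woman 0 := 3))) (Woman 0) = Man 1"
    using stable_Woman_0_lies[OF e] stable unfolding p_def q_def by blast
  have M: "F 3 p (q (ideal(Man 1 := 3))) (Man 1) = Woman 1"
    using stable_Man_1_lies[OF e] stable unfolding p_def q_def by blast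
  consider "F 3 p (q ideal) (Woman 0) = Man 0" | "F 3 p (q ideal) (Man 1) = Woman 0"
    using stable_true[OF e] stable unfolding p_def q_def by blast
  then show False
  proof cases
    case 1
    have "prefers p (q ideal) (Woman 0) (Man 1) (Man 0)"
      unfolding p_def q_def prefers_line[OF e] by (simp add: ideal_def)
    then show False
      using no_gain[of "Woman 0"] W 1 by (simp add: women_3)
  next
    case 2
    have "prefers p (q ideal) (Man 1) (Woman 1) (Woman 0)"
      unfolding p_def q_def prefers_line[OF e] by (simp add: ideal_def)
    then show False
      using no_gain[of "Man 1"] M 2 by (simp add: men_3)
  qed
qed

end
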